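(* Let $\mathbf{rs}$ be the Rudin--Shapiro sequence, $P_{\mathbf{rs}}(n)=\sum_{i=0}^{n-1}p_{\mathbf{rs}}(i)$ and $h_{\mathbf{rs}}(n)=P_{\mathbf{rs}}(n)/n$ for $n\ge1$. There exists a $1$-periodic continuous function $\Phi:\mathbb R\to\mathbb C$ such that \[ P_{\mathbf{rs}}(n)=n^2\,\Phi(\{\log_2 n\})+O(n\log^2 n) \quad\text{and}\quad h_{\mathbf{rs}}(n)=n\,\Phi(\{\log_2 n\})+O(\log^2 n)\] as $n\to\infty$.
   Context: The Rudin--Shapiro sequence $\mathbf{rs}=r_0r_1r_2\cdots=0001001000011101\cdots$ over $\{0,1\}$ is defined by $r_i=0$ if the number of (possibly overlapping) occurrences of the block $11$ in the binary representation of $i$ is even, and $r_i=1$ otherwise. For an infinite word $\mathbf w=w_0w_1w_2\cdots$, the periodicity function $p_{\mathbf w}(i)$ is the length of the shortest nonempty prefix $u$ of $w_iw_{i+1}w_{i+2}\cdots$ such that either $u$ is a suffix of $w_0\cdots w_{i-1}$ or $w_0\cdots w_{i-1}$ is a suffix of $u$ (for $i=0$, $w_0\cdots w_{i-1}$ is the empty word). For a real number $z$, $\{z\}$ denotes its fractional part. *)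

theory Defs
  imports Complex_Main "HOL-Library.Sublist" "HOL-Library.Landau_Symbols"
begin

text \<open>
  A block 11 in the binary representation of \<open>i\<close> is identified by the position \<open>k\<close> of its
  lower digit, so overlapping blocks are counted separately. The digits of \<open>i\<close> beyond the
  leading one are all 0, hence the set below is finite and leading zeros play no role.
\<close>

definition count_11 :: "nat \<Rightarrow> nat" where
  "count_11 i = card {k. bit i k \<and> bit i (Suc k)}"

definition rudin_shapiro :: "nat \<Rightarrow> nat" where
  "rudin_shapiro i = (if even (count_11 i) then 0 else 1)"

definition factor :: "(nat \<Rightarrow> 'a) \<Rightarrow> nat \<Rightarrow> nat \<Rightarrow> 'a list" where
  "factor w i n = map w [i..<i + n]"

text \<open>
  The value is meaningful when some length is admissible; this is the case for all \<open>i\<close> if every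
  prefix of \<open>w\<close> occurs in \<open>w\<close> infinitely often, as for the Rudin--Shapiro sequence.
\<close>

definition periodicity :: "(nat \<Rightarrow> 'a) \<Rightarrow> nat \<Rightarrow> nat" where
  "periodicity w i =
    (LEAST n. n > 0 \<and> (suffix (factor w i n) (factor w 0 i) \<or> suffix (factor w 0 i) (factor w i n)))"

definition sum_periodicity :: "(nat \<Rightarrow> 'a) \<Rightarrow> nat \<Rightarrow> nat" where
  "sum_periodicity w n = (\<Sum>i<n. periodicity w i)"

definition mean_periodicity :: "(nat \<Rightarrow> 'a) \<Rightarrow> nat \<Rightarrow> real" where
  "mean_periodicity w n = real (sum_periodicity w n) / real n"

end

theory Submission imports Defs begin

text \<open>
  The differences \<open>d j\<close> of consecutive terms (modulo 2) are of paperfolding type: if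
  \<open>j + 1 = 2 ^ t * (2 * q + 1)\<close>, then \<open>d j\<close> is the parity of \<open>q + max (t - 1) 0\<close>. Hence an
  even shift \<open>n = 2 ^ (t + 1) * odd\<close> changes \<open>d j\<close> whenever \<open>2 ^ t\<close> is the exact power of two in
  \<open>j + 1\<close>, and an odd shift changes one of any eight consecutive differences. A repetition of
  period \<open>n\<close> therefore has to avoid all such \<open>j\<close>. It follows that a square of half-length \<open>n\<close>
  centred at \<open>i\<close> has \<open>n \<le> 7\<close> or \<open>n = 2 ^ (t + 1)\<close> where \<open>2 ^ t\<close> is the exact power of two in
  \<open>i\<close>, and that the periodicity function takes the value \<open>4 * 2 ^ k\<close> at all \<open>i\<close> with
  \<open>2 ^ k \<le> i < 2 ^ (k + 1)\<close> that are not centres of squares, with negligible exceptions.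

  The set of square centres looks almost the same in all aligned blocks of length \<open>2 ^ t\<close>: two
  blocks differ in \<open>O(t)\<close> places. So its complement has a density \<open>\<delta>\<close>, with discrepancy
  \<open>O(log\<^sup>2 n)\<close>, and \<open>P(n)\<close> is, up to \<open>O(n log\<^sup>2 n)\<close>, the sum of \<open>4 * \<delta> * 2 ^ floor (log 2 i)\<close>
  over \<open>i < n\<close>. With \<open>n = 2 ^ k * x\<close>, \<open>1 \<le> x < 2\<close>, this is \<open>4 * \<delta> * 4 ^ k * (x - 2 / 3)\<close>.
\<close>

section \<open>The difference sequence\<close>

text \<open>Boolean form of the sequence: equality of terms becomes equivalence, and addition modulo
  2 becomes \<open>\<noteq>\<close>.\<close>

abbreviation rs :: "nat \<Rightarrow> bool" where
  "rs i \<equiv> odd (count_11 i)"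

definition rs_diff :: "nat \<Rightarrow> bool" where
  "rs_diff i \<longleftrightarrow> rs i \<noteq> rs (Suc i)"

lemma finite_bits_nat: "finite {k. bit (i::nat) k}"
proof (rule finite_subset)
  show "{k. bit i k} \<subseteq> {..i}"
  proof
    fix k assume "k \<in> {k. bit i k}"
    then have "2 ^ k \<le> i"
      by (auto simp: bit_iff_odd intro!: leI dest: div_less)
    then show "k \<in> {..i}" using less_exp[of k] by (meson atMost_iff le_trans less_imp_le)
  qed
qed simp

lemma count_11_double: "count_11 (2 * i) = count_11 i"
proof -
  have "{k. bit (2 * i) k \<and> bit (2 * i) (Suc k)} = Suc ` {k. bit i k \<and> bit i (Suc k)}"
    (is "?A = ?B")
  proof (rule set_eqI)
    fix k show "k \<in> ?A \<longleftrightarrow> k \<in> ?B" by (cases k) (auto simp: bit_0 bit_Suc)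
  qed
  then show ?thesis by (simp add: count_11_def card_image)
qed

lemma count_11_double_Suc: "count_11 (Suc (2 * i)) = count_11 i + of_bool (odd i)"
proof -
  have fin: "finite {k. bit i k \<and> bit i (Suc k)}"
    by (rule finite_subset[OF _ finite_bits_nat[of i]]) auto
  have "{k. bit (Suc (2 * i)) k \<and> bit (Suc (2 * i)) (Suc k)}
      = Suc ` {k. bit i k \<and> bit i (Suc k)} \<union> (if odd i then {0} else {})" (is "?A = ?B")
  proof (rule set_eqI)
    fix k show "k \<in> ?A \<longleftrightarrow> k \<in> ?B" by (cases k) (auto simp: bit_0 bit_Suc)
  qed
  then show ?thesis using fin
    by (auto simp: count_11_def card_image card_insert_if)
qed

lemma rs_double: "rs (2 * i) = rs i"
  by (simp only: count_11_double)

lemma rs_double_Suc: "rs (Suc (2 * i)) \<longleftrightarrow> rs i \<noteq> odd i"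
  by (auto simp: count_11_double_Suc)

lemma rs_diff_double: "rs_diff (2 * i) \<longleftrightarrow> odd i"
  unfolding rs_diff_def rs_double rs_double_Suc by blast

lemma rs_diff_double_Suc: "rs_diff (Suc (2 * i)) \<longleftrightarrow> rs_diff i \<noteq> odd i"
proof -
  have "Suc (Suc (2 * i)) = 2 * Suc i" by simp
  then show ?thesis
    unfolding rs_diff_def rs_double_Suc by (metis rs_double)
qed

text \<open>Induction on \<open>t\<close>: writing \<open>j = Suc (2 * i)\<close> lowers the
  exponent by one and adds the parity of \<open>i\<close>, which is odd unless \<open>Suc i\<close>
  is odd. The first halving step therefore adds nothing, and the truncated \<open>t - 1\<close>
  covers \<open>t = 0\<close> and \<open>t = 1\<close> alike.\<close>

lemma rs_diff_explicit:
  assumes "Suc j = 2 ^ t * (2 * q + 1)"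
  shows "rs_diff j \<longleftrightarrow> odd (q + (t - 1))"
  using assms
proof (induction t arbitrary: j)
  case 0
  then show ?case using rs_diff_double[of q] by simp
next
  case (Suc t)
  obtain i where i: "Suc i = 2 ^ t * (2 * q + 1)"
    by (metis Suc_pred nat_0_less_mult_iff zero_less_power zero_less_numeral add_gr_0 zero_less_one)
  have j: "j = Suc (2 * i)"
    using Suc.prems i by simp
  have "odd i \<longleftrightarrow> t \<noteq> 0"
  proof -
    have "even (Suc i) \<longleftrightarrow> t \<noteq> 0" unfolding i by simp
    then show ?thesis by simp
  qed
  then show ?case
    unfolding j rs_diff_double_Suc Suc.IH[OF i] by (cases t) auto
qed

text \<open>The shift keeps the exponent of two in \<open>Suc j\<close> and replaces
  \<open>q\<close> by \<open>q + 2 * u + 1\<close>, whose parity is opposite.\<close>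

lemma rs_diff_shift_even:
  assumes "n = 2 ^ Suc t * (2 * u + 1)" and "Suc j = 2 ^ t * (2 * q + 1)"
  shows "rs_diff (j + n) \<noteq> rs_diff j"
proof -
  have "Suc (j + n) = 2 ^ t * (2 * (q + 2 * u + 1) + 1)"
    using assms by (simp add: algebra_simps)
  from rs_diff_explicit[OF this] rs_diff_explicit[OF assms(2)] show ?thesis by auto
qed

text \<open>Choose \<open>j\<close> among four consecutive positions with \<open>j + n\<close>
  congruent to 1 modulo 4. Then \<open>j\<close> is even, so \<open>rs_diff\<close> agrees at
  \<open>j\<close> and \<open>j + 4\<close>, whereas it differs at \<open>j + n\<close> and
  \<open>j + 4 + n\<close>. One of \<open>j\<close>, \<open>j + 4\<close> must be changed by the
  shift.\<close>

lemma rs_diff_shift_odd: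
  assumes "odd n"
  obtains j where "a \<le> j" "j < a + 8" "rs_diff (j + n) \<noteq> rs_diff j"
proof -
  obtain c where c: "c < 4" "(a + c + n) mod 4 = 1"
  proof -
    have "(a + n) mod 4 = 0 \<or> (a + n) mod 4 = 1 \<or> (a + n) mod 4 = 2 \<or> (a + n) mod 4 = 3" by linarith
    then have "\<exists>c<4. (a + c + n) mod 4 = 1"
    proof (elim disjE)
      assume "(a + n) mod 4 = 0" then show ?thesis by (intro exI[of _ 1]) presburger
    next
      assume "(a + n) mod 4 = 1" then show ?thesis by (intro exI[of _ 0]) presburger
    next
      assume "(a + n) mod 4 = 2" then show ?thesis by (intro exI[of _ 3]) presburger
    next
      assume "(a + n) mod 4 = 3" then show ?thesis by (intro exI[of _ 2]) presburger
    qed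
    with that show ?thesis by blast
  qed
  define j where "j = a + c"
  obtain q where q: "j + n = 4 * q + 1"
    using c(2) mult_div_mod_eq[of 4 "j + n"] unfolding j_def by metis
  have "even j" using q assms by presburger
  then obtain i where i: "j = 2 * i" by blast
  have "j + 4 = 2 * (i + 2)" using i by simp
  then have 1: "rs_diff j = rs_diff (j + 4)"
    using rs_diff_double[of i] rs_diff_double[of "i + 2"] i by (metis even_add even_numeral)
  have "Suc (j + n) = 2 ^ 1 * (2 * q + 1)" "Suc (j + 4 + n) = 2 ^ 1 * (2 * (q + 1) + 1)"
    using q by auto
  from this[THEN rs_diff_explicit] have "rs_diff (j + n) \<noteq> rs_diff (j + 4 + n)" by simp
  with 1 have "rs_diff (j + n) \<noteq> rs_diff j \<or> rs_diff (j + 4 + n) \<noteq> rs_diff (j + 4)" by blast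
  then show ?thesis using that[of j] that[of "j + 4"] c(1) j_def by auto
qed

section \<open>Squares in the Rudin--Shapiro sequence\<close>

definition square_at :: "nat \<Rightarrow> nat \<Rightarrow> bool" where
  "square_at n i \<longleftrightarrow> n \<le> i \<and> (\<forall>j<n. rs (i - n + j) = rs (i + j))"

lemma rs_diff_eq:
  assumes "\<forall>j. a \<le> j \<and> j < b \<longrightarrow> rs (j + n) = rs j" "a \<le> j" "Suc j < b"
  shows "rs_diff (j + n) = rs_diff j"
proof -
  have "rs (j + n) = rs j" "rs (Suc j + n) = rs (Suc j)"
    using assms by (auto simp del: add_Suc)
  then show ?thesis unfolding rs_diff_def by simp
qed

text \<open>This brings squares to the form of a period \<open>n\<close> on a window, shared with
  the case of a long repetition word, so that \<open>rs_period_odd\<close> and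
  \<open>rs_period_even\<close> serve both.\<close>

lemma square_at_alt:
  "square_at n i \<longleftrightarrow> n \<le> i \<and> (\<forall>j. i - n \<le> j \<and> j < i \<longrightarrow> rs (j + n) = rs j)"
proof (cases "n \<le> i")
  case True
  show ?thesis
  proof
    assume sq: "square_at n i"
    have "rs (j + n) = rs j" if "i - n \<le> j" "j < i" for j
    proof -
      have "j - (i - n) < n" "i - n + (j - (i - n)) = j" "i + (j - (i - n)) = j + n"
        using that True by auto
      then show ?thesis using sq unfolding square_at_def by metis
    qed
    with True show "n \<le> i \<and> (\<forall>j. i - n \<le> j \<and> j < i \<longrightarrow> rs (j + n) = rs j)" by blast
  next
    assume "n \<le> i \<and> (\<forall>j. i - n \<le> j \<and> j < i \<longrightarrow> rs (j + n) = rs j)"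
    then have *: "\<And>j. i - n \<le> j \<Longrightarrow> j < i \<Longrightarrow> rs (j + n) = rs j" by blast
    have "rs (i - n + j) = rs (i + j)" if "j < n" for j
    proof -
      have "i - n + j + n = i + j" using True by simp
      then show ?thesis using *[of "i - n + j"] that True by (metis le_add1 nat_add_left_cancel_less le_add_diff_inverse2)
    qed
    with True show "square_at n i" unfolding square_at_def by blast
  qed
qed (auto simp: square_at_def)

lemma odd_part_exists:
  fixes n :: nat
  assumes "n > 0"
  obtains t u where "n = 2 ^ t * (2 * u + 1)"
  using assms
proof (induction n arbitrary: thesis rule: less_induct)
  case (less n)
  show ?case
  proof (cases "even n")
    case True
    then obtain m where m: "n = 2 * m" by blast
    with less obtain t u where "m = 2 ^ t * (2 * u + 1)" by (metis nat_0_less_mult_iff less_add_same_cancel1 mult_2)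
    then show ?thesis using less.prems(1)[of "Suc t" u] m by simp
  next
    case False
    then obtain u where "n = 2 * u + 1" by (elim oddE)
    then show ?thesis using less.prems(1)[of 0 u] by simp
  qed
qed

text \<open>Nine positions carry eight consecutive differences, one of which an odd shift
  changes.\<close>

lemma rs_period_odd:
  assumes "\<forall>j. a \<le> j \<and> j < b \<longrightarrow> rs (j + n) = rs j" "odd n"
  shows "b < a + 9"
proof (rule ccontr)
  assume "\<not> b < a + 9"
  moreover obtain j where "a \<le> j" "j < a + 8" "rs_diff (j + n) \<noteq> rs_diff j"
    using rs_diff_shift_odd[OF assms(2)] .
  ultimately show False using rs_diff_eq[OF assms(1), of j] by simp
qed

text \<open>The difference between an odd multiple of \<open>2 ^ t\<close> and its predecessor is
  changed by the shift. The window cannot contain both positions, so it ends before the first odd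
  multiple beyond \<open>a\<close>.\<close>

lemma rs_period_even:
  assumes "\<forall>j. a \<le> j \<and> j < b \<longrightarrow> rs (j + n) = rs j" "n = 2 ^ Suc t * (2 * u + 1)"
    and "a < 2 ^ t * (2 * q + 1)"
  shows "b \<le> 2 ^ t * (2 * q + 1)"
proof (rule ccontr)
  assume *: "\<not> b \<le> 2 ^ t * (2 * q + 1)"
  define j where "j = 2 ^ t * (2 * q + 1) - 1"
  have j: "Suc j = 2 ^ t * (2 * q + 1)" using assms(3) unfolding j_def by simp
  have "rs_diff (j + n) = rs_diff j"
    using assms(3) * unfolding j[symmetric] by (intro rs_diff_eq[OF assms(1)]) auto
  with rs_diff_shift_even[OF assms(2) j] show False by simp
qed

lemma square_at_odd:
  assumes "square_at n i" "odd n"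
  shows "n \<in> {1, 3, 5, 7}"
proof -
  from assms(1) have "n \<le> i" "\<forall>j. i - n \<le> j \<and> j < i \<longrightarrow> rs (j + n) = rs j"
    unfolding square_at_alt by auto
  with rs_period_odd[OF this(2) assms(2)] have "n < 9" by linarith
  then have "n = 0 \<or> n = 1 \<or> n = 2 \<or> n = 3 \<or> n = 4 \<or> n = 5 \<or> n = 6 \<or> n = 7 \<or> n = 8" by linarith
  then show ?thesis using assms(2) by auto
qed

text \<open>Odd multiples of \<open>2 ^ t\<close> are \<open>2 ^ Suc t\<close> apart and none lies
  strictly between the ends \<open>i - n\<close> and \<open>i\<close>. As \<open>n\<close> is at
  least this distance, it equals it, and both ends are odd multiples.\<close>

lemma square_at_even:
  assumes sq: "square_at n i" and "even n" "n > 0"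
  obtains t q where "n = 2 ^ Suc t" "i = 2 ^ t * (2 * q + 1)"
proof -
  obtain m where m: "n = 2 * m" "m > 0" using assms(2,3) by auto
  obtain t u where tu: "m = 2 ^ t * (2 * u + 1)" using odd_part_exists[OF m(2)] .
  have n: "n = 2 ^ Suc t * (2 * u + 1)" using m tu by simp
  have le: "n \<le> i" and per: "\<forall>j. i - n \<le> j \<and> j < i \<longrightarrow> rs (j + n) = rs j"
    using sq unfolding square_at_alt by auto
  \<comment> \<open>the first odd multiple of \<open>2 ^ t\<close> beyond \<open>i - n\<close>; it is not less than \<open>i\<close>, which leaves no room for a period other than \<open>2 ^ Suc t\<close>\<close>
  define P where "P q \<longleftrightarrow> i - n < 2 ^ t * (2 * q + 1)" for q
  define q where "q = (LEAST q. P q)"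
  have "P i" unfolding P_def
  proof -
    have "i < 2 ^ t * (2 * i + 1)"
      by (metis Suc_eq_plus1 le_add1 le_imp_less_Suc less_le_trans mult_2 mult_le_mono1 nat_mult_1 one_le_numeral one_le_power)
    then show "i - n < 2 ^ t * (2 * i + 1)" by simp
  qed
  then have "P q" unfolding q_def by (rule LeastI)
  then have 1: "i \<le> 2 ^ t * (2 * q + 1)"
    using rs_period_even[OF per n] unfolding P_def by blast
  \<comment> \<open>By minimality of \<open>q\<close> the preceding odd multiple is at most
    \<open>i - n\<close>; for \<open>q = 0\<close> there is none, but \<open>2 ^ t\<close> is small
    enough.\<close>
  have 2: "2 ^ t * (2 * q + 1) \<le> i - n + 2 ^ Suc t"
  proof (cases q)
    case 0
    then show ?thesis by simp
  next
    case (Suc r)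
    then have "\<not> P r" unfolding q_def by (metis not_less_Least lessI)
    then have "2 ^ t * (2 * r + 1) \<le> i - n" unfolding P_def by simp
    then show ?thesis unfolding Suc by (simp add: algebra_simps)
  qed
  have "n \<le> 2 ^ Suc t" using 1 2 le by linarith
  moreover have "u = 0"
  proof (rule ccontr)
    assume "u \<noteq> 0"
    then have "2 ^ Suc t * 1 < 2 ^ Suc t * (2 * u + 1)" by (intro mult_strict_left_mono) auto
    with n \<open>n \<le> 2 ^ Suc t\<close> show False by linarith
  qed
  ultimately have "n = 2 ^ Suc t" using n by simp
  moreover from this have "i = 2 ^ t * (2 * q + 1)" using 1 2 le by linarith
  ultimately show ?thesis using that by blast
qed

text \<open>Terms at even positions are those of the halved word. Terms at odd positions acquire the
  parity of the halved index, which is the same in both halves because \<open>n\<close> is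
  even.\<close>

lemma square_at_double:
  assumes "even n"
  shows "square_at (2 * n) (2 * i) \<longleftrightarrow> square_at n i"
proof (cases "n \<le> i")
  case True
  have e: "rs (2 * i - 2 * n + 2 * j) = rs (2 * i + 2 * j) \<longleftrightarrow> rs (i - n + j) = rs (i + j)" for j
  proof -
    have "2 * i - 2 * n + 2 * j = 2 * (i - n + j)" "2 * i + 2 * j = 2 * (i + j)" using True by auto
    then show ?thesis by (simp only: rs_double)
  qed
  have o: "rs (2 * i - 2 * n + Suc (2 * j)) = rs (2 * i + Suc (2 * j)) \<longleftrightarrow> rs (i - n + j) = rs (i + j)" for j
  proof -
    have "2 * i - 2 * n + Suc (2 * j) = Suc (2 * (i - n + j))" "2 * i + Suc (2 * j) = Suc (2 * (i + j))"
      using True by auto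
    moreover have "odd (i - n + j) = odd (i + j)" using True assms by simp
    ultimately show ?thesis by (simp only: rs_double_Suc) blast
  qed
  have "(\<forall>j<2*n. Q j) \<longleftrightarrow> (\<forall>j<n. Q (2 * j) \<and> Q (Suc (2 * j)))" for Q :: "nat \<Rightarrow> bool"
  proof (intro iffI allI impI)
    fix j assume a: "\<forall>j<n. Q (2 * j) \<and> Q (Suc (2 * j))" and "j < 2 * n"
    then have "j div 2 < n" by auto
    with a show "Q j" by (metis dvd_mult_div_cancel odd_two_times_div_two_succ Suc_eq_plus1)
  qed auto
  note split = this[of "\<lambda>j. rs (2 * i - 2 * n + j) = rs (2 * i + j)"]
  have "(rs (2 * i - 2 * n + 2 * j) = rs (2 * i + 2 * j) \<and>
      rs (2 * i - 2 * n + Suc (2 * j)) = rs (2 * i + Suc (2 * j))) \<longleftrightarrow> rs (i - n + j) = rs (i + j)" for j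
    using e[of j] o[of j] by blast
  with split have "(\<forall>j<2*n. rs (2 * i - 2 * n + j) = rs (2 * i + j)) \<longleftrightarrow> (\<forall>j<n. rs (i - n + j) = rs (i + j))"
    by presburger
  with True show ?thesis unfolding square_at_def by (metis mult_le_mono2)
qed (simp add: square_at_def)

text \<open>By \<open>square_at_even\<close> this accounts for all squares of positive even
  half-length.\<close>

definition pow_square_at :: "nat \<Rightarrow> bool" where
  "pow_square_at i \<longleftrightarrow> (\<exists>t. square_at (2 ^ Suc t) i)"

text \<open>A square of half-length at least 4 of this kind has an even centre, and halving it gives
  one of half the size. Half-length 2 starts the recursion.\<close>

lemma pow_square_at_rec:
  "pow_square_at i \<longleftrightarrow> square_at 2 i \<or> even i \<and> pow_square_at (i div 2)"
proof
  assume "pow_square_at i"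
  then obtain t where t: "square_at (2 ^ Suc t) i" unfolding pow_square_at_def ..
  show "square_at 2 i \<or> even i \<and> pow_square_at (i div 2)"
  proof (cases t)
    case 0
    with t show ?thesis by simp
  next
    case (Suc s)
    obtain t' q where "(2::nat) ^ Suc t = 2 ^ Suc t'" "i = 2 ^ t' * (2 * q + 1)"
      using square_at_even[OF t] by auto
    moreover from this(1) have "t' = t" by simp
    ultimately have "even i" using Suc by auto
    then obtain k where k: "i = 2 * k" by blast
    have "square_at (2 * 2 ^ Suc s) (2 * k)" using t Suc k by simp
    then have "square_at (2 ^ Suc s) k" by (subst (asm) square_at_double) auto
    then show ?thesis using k unfolding pow_square_at_def by auto
  qed
next
  assume "square_at 2 i \<or> even i \<and> pow_square_at (i div 2)"
  then show "pow_square_at i"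
  proof
    assume "square_at 2 i"
    then show ?thesis unfolding pow_square_at_def by (intro exI[of _ 0]) simp
  next
    assume "even i \<and> pow_square_at (i div 2)"
    then obtain t where t: "square_at (2 ^ Suc t) (i div 2)" "i = 2 * (i div 2)"
      unfolding pow_square_at_def by auto
    then have "square_at (2 * 2 ^ Suc t) (2 * (i div 2))" by (subst square_at_double) auto
    then show ?thesis using t(2) unfolding pow_square_at_def by (metis power_Suc)
  qed
qed

definition square_centre :: "nat \<Rightarrow> bool" where
  "square_centre i \<longleftrightarrow> (\<exists>n>0. square_at n i)"

lemma square_centre_iff:
  "square_centre i \<longleftrightarrow>
    square_at 1 i \<or> square_at 3 i \<or> square_at 5 i \<or> square_at 7 i \<or> pow_square_at i"
proof
  assume "square_centre i"
  then obtain n where n: "n > 0" "square_at n i" unfolding square_centre_def by blast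
  show "square_at 1 i \<or> square_at 3 i \<or> square_at 5 i \<or> square_at 7 i \<or> pow_square_at i"
  proof (cases "even n")
    case True
    with square_at_even[OF n(2)] n show ?thesis unfolding pow_square_at_def by metis
  next
    case False
    with square_at_odd[OF n(2)] n(2) show ?thesis by auto
  qed
next
  have "(0::nat) < 1" "(0::nat) < 3" "(0::nat) < 5" "(0::nat) < 7" "\<And>t. (0::nat) < 2 ^ Suc t" by auto
  moreover assume "square_at 1 i \<or> square_at 3 i \<or> square_at 5 i \<or> square_at 7 i \<or> pow_square_at i"
  ultimately show "square_centre i" unfolding square_centre_def pow_square_at_def by blast
qed

section \<open>Comparison of aligned dyadic blocks\<close>

text \<open>The block number \<open>a\<close> of length \<open>2 ^ t\<close> is compared with the
  initial block; bounds are wanted uniformly in \<open>a\<close>.\<close>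

definition mismatches :: "(nat \<Rightarrow> bool) \<Rightarrow> nat \<Rightarrow> nat \<Rightarrow> nat set" where
  "mismatches X a t = {s. s < 2 ^ t \<and> X (a * 2 ^ t + s) \<noteq> X s}"

definition bounded_mismatch :: "(nat \<Rightarrow> bool) \<Rightarrow> bool" where
  "bounded_mismatch X \<longleftrightarrow> (\<exists>K. \<forall>a t. card (mismatches X a t) \<le> K)"

definition linear_mismatch :: "(nat \<Rightarrow> bool) \<Rightarrow> bool" where
  "linear_mismatch X \<longleftrightarrow> (\<exists>K. \<forall>a t. card (mismatches X a t) \<le> K * (t + 1))"

lemma finite_mismatches [simp]: "finite (mismatches X a t)"
  unfolding mismatches_def by simp

lemma bounded_mismatch_imp_linear: "bounded_mismatch X \<Longrightarrow> linear_mismatch X"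
  unfolding bounded_mismatch_def linear_mismatch_def
  by (metis add.commute le_add1 le_trans mult.right_neutral mult_le_mono2)

lemma card_mismatches_combine:
  "card (mismatches (\<lambda>i. f (X i) (Y i)) a t) \<le> card (mismatches X a t) + card (mismatches Y a t)"
proof -
  have "mismatches (\<lambda>i. f (X i) (Y i)) a t \<subseteq> mismatches X a t \<union> mismatches Y a t"
  proof
    fix s assume "s \<in> mismatches (\<lambda>i. f (X i) (Y i)) a t"
    then have s: "s < 2 ^ t" "f (X (a * 2 ^ t + s)) (Y (a * 2 ^ t + s)) \<noteq> f (X s) (Y s)"
      unfolding mismatches_def by simp_all
    from s(2) have "X (a * 2 ^ t + s) \<noteq> X s \<or> Y (a * 2 ^ t + s) \<noteq> Y s"
      by (rule contrapos_pp) simp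
    with s(1) show "s \<in> mismatches X a t \<union> mismatches Y a t" unfolding mismatches_def by blast
  qed
  then have "card (mismatches (\<lambda>i. f (X i) (Y i)) a t) \<le> card (mismatches X a t \<union> mismatches Y a t)"
    by (rule card_mono[rotated]) simp
  then show ?thesis using card_Un_le le_trans by blast
qed

lemma bounded_mismatch_combine:
  assumes "bounded_mismatch X" "bounded_mismatch Y"
  shows "bounded_mismatch (\<lambda>i. f (X i) (Y i))"
proof -
  from assms obtain K L where "\<And>a t. card (mismatches X a t) \<le> K" "\<And>a t. card (mismatches Y a t) \<le> L"
    unfolding bounded_mismatch_def by blast
  then have "card (mismatches (\<lambda>i. f (X i) (Y i)) a t) \<le> K + L" for a t
    using card_mismatches_combine[of f X Y a t] by (meson add_mono le_trans)
  then show ?thesis unfolding bounded_mismatch_def by blast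
qed

lemma linear_mismatch_combine:
  assumes "linear_mismatch X" "linear_mismatch Y"
  shows "linear_mismatch (\<lambda>i. f (X i) (Y i))"
proof -
  from assms obtain K L where "\<And>a t. card (mismatches X a t) \<le> K * (t + 1)" "\<And>a t. card (mismatches Y a t) \<le> L * (t + 1)"
    unfolding linear_mismatch_def by blast
  then have "card (mismatches (\<lambda>i. f (X i) (Y i)) a t) \<le> (K + L) * (t + 1)" for a t
    using card_mismatches_combine[of f X Y a t] unfolding add_mult_distrib by (meson add_mono le_trans)
  then show ?thesis unfolding linear_mismatch_def by blast
qed

lemma bounded_mismatch_const: "bounded_mismatch (\<lambda>i. c)"
  unfolding bounded_mismatch_def mismatches_def by simp

lemma bounded_mismatch_all:
  assumes "\<And>j. bounded_mismatch (X j)"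
  shows "bounded_mismatch (\<lambda>i. \<forall>j<(m::nat). X j i)"
proof (induction m)
  case 0
  then show ?case using bounded_mismatch_const[of True] by simp
next
  case (Suc m)
  then show ?case
    using bounded_mismatch_combine[OF assms[of m] Suc, of "(\<and>)"] by (simp only: All_less_Suc)
qed

text \<open>Mismatches move by one place; only the last position of a block looks into the next
  block.\<close>

lemma bounded_mismatch_Suc:
  assumes "bounded_mismatch X"
  shows "bounded_mismatch (\<lambda>i. X (Suc i))"
proof -
  from assms obtain K where K: "\<And>a t. card (mismatches X a t) \<le> K"
    unfolding bounded_mismatch_def by blast
  have "card (mismatches (\<lambda>i. X (Suc i)) a t) \<le> Suc K" for a t
  proof -
    have "mismatches (\<lambda>i. X (Suc i)) a t \<subseteq> insert (2 ^ t - 1) ((\<lambda>u. u - 1) ` mismatches X a t)"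
    proof
      fix s assume s: "s \<in> mismatches (\<lambda>i. X (Suc i)) a t"
      show "s \<in> insert (2 ^ t - 1) ((\<lambda>u. u - 1) ` mismatches X a t)"
      proof (cases "Suc s < 2 ^ t")
        case True
        with s have "Suc s \<in> mismatches X a t" unfolding mismatches_def by auto
        then show ?thesis by (metis diff_Suc_1 image_eqI insertI2)
      next
        case False
        with s have "s = 2 ^ t - 1" unfolding mismatches_def by auto
        then show ?thesis by simp
      qed
    qed
    then have "card (mismatches (\<lambda>i. X (Suc i)) a t) \<le> card (insert (2 ^ t - 1) ((\<lambda>u. u - 1) ` mismatches X a t))"
      by (rule card_mono[rotated]) simp
    also have "\<dots> \<le> Suc (card ((\<lambda>u. u - 1) ` mismatches X a t))" by (rule card_insert_le_m1) auto
    also have "\<dots> \<le> Suc K" using K card_image_le[OF finite_mismatches] le_trans by blast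
    finally show ?thesis .
  qed
  then show ?thesis unfolding bounded_mismatch_def by blast
qed

lemma bounded_mismatch_add: "bounded_mismatch X \<Longrightarrow> bounded_mismatch (\<lambda>i. X (i + c))"
proof (induction c)
  case (Suc c)
  from bounded_mismatch_Suc[OF Suc.IH[OF Suc.prems]] show ?case by simp
qed simp

text \<open>Only the first \<open>c\<close> positions of a block look back beyond it; all other
  mismatches are shifted ones of \<open>X\<close>.\<close>

lemma bounded_mismatch_diff:
  assumes "bounded_mismatch X"
  shows "bounded_mismatch (\<lambda>i. c \<le> i \<and> X (i - c))"
proof -
  from assms obtain K where K: "\<And>a t. card (mismatches X a t) \<le> K"
    unfolding bounded_mismatch_def by blast
  have "card (mismatches (\<lambda>i. c \<le> i \<and> X (i - c)) a t) \<le> c + K" for a t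
  proof -
    have "mismatches (\<lambda>i. c \<le> i \<and> X (i - c)) a t \<subseteq> {..<c} \<union> (\<lambda>u. u + c) ` mismatches X a t"
    proof
      fix s assume s: "s \<in> mismatches (\<lambda>i. c \<le> i \<and> X (i - c)) a t"
      show "s \<in> {..<c} \<union> (\<lambda>u. u + c) ` mismatches X a t"
      proof (cases "s < c")
        case False
        then have "a * 2 ^ t + s - c = a * 2 ^ t + (s - c)" "c \<le> s" "c \<le> a * 2 ^ t + s" by simp_all
        moreover have "s < 2 ^ t" "(c \<le> a * 2 ^ t + s \<and> X (a * 2 ^ t + s - c)) \<noteq> (c \<le> s \<and> X (s - c))"
          using s unfolding mismatches_def by simp_all
        ultimately have "s - c < 2 ^ t" "X (a * 2 ^ t + (s - c)) \<noteq> X (s - c)" by simp_all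
        then have "s - c \<in> mismatches X a t" unfolding mismatches_def by simp
        then show ?thesis using \<open>c \<le> s\<close> by (metis UnI2 imageI le_add_diff_inverse2)
      qed simp
    qed
    then have "card (mismatches (\<lambda>i. c \<le> i \<and> X (i - c)) a t) \<le> card ({..<c} \<union> (\<lambda>u. u + c) ` mismatches X a t)"
      by (rule card_mono[rotated]) simp
    also have "\<dots> \<le> c + card ((\<lambda>u. u + c) ` mismatches X a t)"
      using card_Un_le[of "{..<c}"] by simp
    also have "\<dots> \<le> c + K" using K card_image_le[OF finite_mismatches] le_trans by (metis nat_add_left_cancel_le)
    finally show ?thesis .
  qed
  then show ?thesis unfolding bounded_mismatch_def by blast
qed

text \<open>At even positions \<open>rs_diff\<close> is determined modulo 4, so blocks of length at
  least 4 agree there. At odd positions mismatches come from blocks of half the length. Hence their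
  number does not grow beyond that for length 2.\<close>

lemma bounded_mismatch_rs_diff: "bounded_mismatch rs_diff"
proof -
  have step: "mismatches rs_diff a (Suc (Suc t)) \<subseteq> (\<lambda>s. Suc (2 * s)) ` mismatches rs_diff a (Suc t)" for a t
  proof
    fix s assume s: "s \<in> mismatches rs_diff a (Suc (Suc t))"
    show "s \<in> (\<lambda>s. Suc (2 * s)) ` mismatches rs_diff a (Suc t)"
    proof (cases "even s")
      case True
      then obtain k where k: "s = 2 * k" by blast
      have "rs_diff (a * 2 ^ Suc (Suc t) + s) = rs_diff s"
        using rs_diff_double[of "a * 2 ^ Suc t + k"] rs_diff_double[of k] unfolding k by (simp add: algebra_simps)
      with s show ?thesis unfolding mismatches_def by blast
    next
      case False
      then obtain k where k: "s = Suc (2 * k)" by (metis oddE Suc_eq_plus1)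
      have "a * 2 ^ Suc (Suc t) + s = Suc (2 * (a * 2 ^ Suc t + k))" unfolding k by simp
      then have "rs_diff (a * 2 ^ Suc (Suc t) + s) \<longleftrightarrow> rs_diff (a * 2 ^ Suc t + k) \<noteq> odd (a * 2 ^ Suc t + k)"
        by (simp only: rs_diff_double_Suc)
      moreover have "rs_diff s \<longleftrightarrow> rs_diff k \<noteq> odd k" unfolding k by (rule rs_diff_double_Suc)
      moreover have "odd (a * 2 ^ Suc t + k) = odd k" by simp
      moreover have "s < 2 ^ Suc (Suc t)" "rs_diff (a * 2 ^ Suc (Suc t) + s) \<noteq> rs_diff s"
        using s unfolding mismatches_def by auto
      ultimately have "rs_diff (a * 2 ^ Suc t + k) \<noteq> rs_diff k" by blast
      moreover have "k < 2 ^ Suc t" using \<open>s < 2 ^ Suc (Suc t)\<close> k by simp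
      ultimately have "k \<in> mismatches rs_diff a (Suc t)" unfolding mismatches_def by blast
      with k show ?thesis by blast
    qed
  qed
  have le: "card (mismatches rs_diff a t) \<le> 2 ^ t" for a t
    using card_mono[of "{..<2 ^ t}" "mismatches rs_diff a t"] unfolding mismatches_def by auto
  have "card (mismatches rs_diff a (Suc t)) \<le> 2" for a t
  proof (induction t)
    case 0
    show ?case using le[of a 1] by simp
  next
    case (Suc t)
    have "card (mismatches rs_diff a (Suc (Suc t))) \<le> card ((\<lambda>s. Suc (2 * s)) ` mismatches rs_diff a (Suc t))"
      by (rule card_mono[OF _ step]) simp
    also have "\<dots> \<le> card (mismatches rs_diff a (Suc t))" by (rule card_image_le) simp
    finally show ?case using Suc by linarith
  qed
  moreover have "card (mismatches rs_diff a 0) \<le> 2" for a using le[of a 0] by simp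
  ultimately have "card (mismatches rs_diff a t) \<le> 2" for a t by (cases t) auto
  then show ?thesis unfolding bounded_mismatch_def by blast
qed

text \<open>Terms at distance \<open>n\<close> agree exactly if an even number of the
  \<open>n\<close> differences between them is nonzero; induction on \<open>n\<close> adds one
  shifted \<open>rs_diff\<close> at a time.\<close>

lemma bounded_mismatch_rs_eq: "bounded_mismatch (\<lambda>i. rs (i + n) = rs i)"
proof (induction n)
  case 0
  then show ?case using bounded_mismatch_const[of True] by simp
next
  case (Suc n)
  have "(rs (i + Suc n) = rs i) \<longleftrightarrow> (rs (i + n) = rs i) \<noteq> rs_diff (i + n)" for i
    unfolding rs_diff_def by auto
  then show ?case
    using bounded_mismatch_combine[OF Suc bounded_mismatch_add[OF bounded_mismatch_rs_diff], of "(\<noteq>)"]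
    by presburger
qed

text \<open>A square is a conjunction of \<open>n\<close> shifted equalities. The bound obtained
  depends on \<open>n\<close>, so infinitely many half-lengths cannot be combined this way.\<close>

lemma bounded_mismatch_square_at: "bounded_mismatch (square_at n)"
proof -
  have "bounded_mismatch (\<lambda>i. \<forall>j<n. rs (i + j + n) = rs (i + j))"
    by (intro bounded_mismatch_all bounded_mismatch_add[OF bounded_mismatch_rs_eq])
  then have "bounded_mismatch (\<lambda>i. n \<le> i \<and> (\<forall>j<n. rs (i - n + j + n) = rs (i - n + j)))"
    by (rule bounded_mismatch_diff)
  moreover have "(\<lambda>i. n \<le> i \<and> (\<forall>j<n. rs (i - n + j + n) = rs (i - n + j))) = square_at n"
  proof
    fix i
    have "i - n + j + n = i + j" if "n \<le> i" for j using that by simp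
    then show "(n \<le> i \<and> (\<forall>j<n. rs (i - n + j + n) = rs (i - n + j))) = square_at n i"
      unfolding square_at_def by (metis (no_types, lifting))
  qed
  ultimately show ?thesis by simp
qed

text \<open>By \<open>pow_square_at_rec\<close> each doubling of the block length adds only
  mismatches of half-length 2, at most \<open>K\<close>; the others are doubles of mismatches one
  level below.\<close>

lemma linear_mismatch_pow_square_at: "linear_mismatch pow_square_at"
proof -
  obtain K where K: "\<And>a t. card (mismatches (square_at 2) a t) \<le> K"
    using bounded_mismatch_square_at unfolding bounded_mismatch_def by blast
  have "card (mismatches pow_square_at a t) \<le> 1 + K * t" for a t
  proof (induction t)
    case 0
    have "card (mismatches pow_square_at a 0) \<le> card {..<1::nat}"
      by (rule card_mono) (auto simp: mismatches_def)
    then show ?case by simp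
  next
    case (Suc t)
    have "mismatches pow_square_at a (Suc t)
        \<subseteq> mismatches (square_at 2) a (Suc t) \<union> (\<lambda>s. 2 * s) ` mismatches pow_square_at a t"
    proof
      fix s assume s: "s \<in> mismatches pow_square_at a (Suc t)"
      show "s \<in> mismatches (square_at 2) a (Suc t) \<union> (\<lambda>s. 2 * s) ` mismatches pow_square_at a t"
      proof (cases "s \<in> mismatches (square_at 2) a (Suc t)")
        case False
        have lt: "s < 2 ^ Suc t" and ne: "pow_square_at (a * 2 ^ Suc t + s) \<noteq> pow_square_at s"
          using s unfolding mismatches_def by auto
        have "square_at 2 (a * 2 ^ Suc t + s) = square_at 2 s"
          using False lt unfolding mismatches_def by blast
        with ne have "(even (a * 2 ^ Suc t + s) \<and> pow_square_at ((a * 2 ^ Suc t + s) div 2))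
            \<noteq> (even s \<and> pow_square_at (s div 2))"
          unfolding pow_square_at_rec[of "a * 2 ^ Suc t + s"] pow_square_at_rec[of s] by blast
        moreover have "even (a * 2 ^ Suc t + s) = even s" by simp
        moreover have "(a * 2 ^ Suc t + s) div 2 = a * 2 ^ t + s div 2"
          using div_mult_self3[of 2 "a * 2 ^ t" s] by (simp add: mult.left_commute)
        ultimately have "even s" "pow_square_at (a * 2 ^ t + s div 2) \<noteq> pow_square_at (s div 2)" by auto
        moreover have "s div 2 < 2 ^ t" using lt by simp
        ultimately have "s div 2 \<in> mismatches pow_square_at a t" "s = 2 * (s div 2)"
          unfolding mismatches_def by auto
        then show ?thesis by blast
      qed simp
    qed
    then have "card (mismatches pow_square_at a (Suc t))
        \<le> card (mismatches (square_at 2) a (Suc t) \<union> (\<lambda>s. 2 * s) ` mismatches pow_square_at a t)"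
      by (rule card_mono[rotated]) simp
    also have "\<dots> \<le> card (mismatches (square_at 2) a (Suc t)) + card ((\<lambda>s. 2 * s) ` mismatches pow_square_at a t)"
      by (rule card_Un_le)
    also have "\<dots> \<le> K + card (mismatches pow_square_at a t)"
      by (intro add_mono K card_image_le) simp
    also have "\<dots> \<le> 1 + K * Suc t" using Suc by simp
    finally show ?case .
  qed
  moreover have "1 + K * t \<le> (1 + K) * (t + 1)" for t by simp
  ultimately show ?thesis unfolding linear_mismatch_def by (meson le_trans)
qed

lemma linear_mismatch_no_square: "linear_mismatch (\<lambda>i. \<not> square_centre i)"
proof -
  note sq = bounded_mismatch_imp_linear[OF bounded_mismatch_square_at]
  note or = linear_mismatch_combine[where f = "(\<or>)"]
  have "linear_mismatch square_centre"
    unfolding square_centre_iff[abs_def]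
    by (rule or[OF sq or[OF sq or[OF sq or[OF sq linear_mismatch_pow_square_at]]]])
  \<comment> \<open>Negation is treated as a binary combination of the predicate with
    itself.\<close>
  from linear_mismatch_combine[OF this this, of "\<lambda>x y. \<not> x"] show ?thesis .
qed

section \<open>Densities\<close>

definition count_below :: "(nat \<Rightarrow> bool) \<Rightarrow> nat \<Rightarrow> nat" where
  "count_below X N = card {i. i < N \<and> X i}"

lemma count_below_add:
  "count_below X (p + m) = count_below X p + card {s. s < m \<and> X (p + s)}"
proof -
  have "{i. i < p + m \<and> X i} = {i. i < p \<and> X i} \<union> (\<lambda>s. p + s) ` {s. s < m \<and> X (p + s)}"
  proof (rule set_eqI)
    fix i
    show "i \<in> {i. i < p + m \<and> X i} \<longleftrightarrow> i \<in> {i. i < p \<and> X i} \<union> (\<lambda>s. p + s) ` {s. s < m \<and> X (p + s)}"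
    proof (cases "i < p")
      case False
      then obtain s where "i = p + s" by (metis le_iff_add not_less)
      then show ?thesis by auto
    qed auto
  qed
  then have "count_below X (p + m) = card ({i. i < p \<and> X i} \<union> (\<lambda>s. p + s) ` {s. s < m \<and> X (p + s)})"
    unfolding count_below_def by simp
  also have "\<dots> = card {i. i < p \<and> X i} + card ((\<lambda>s. p + s) ` {s. s < m \<and> X (p + s)})"
    by (rule card_Un_disjoint) auto
  finally show ?thesis by (simp add: count_below_def card_image)
qed

lemma count_below_block:
  assumes "m \<le> 2 ^ t"
  shows "\<bar>real (count_below X (a * 2 ^ t + m)) - real (count_below X (a * 2 ^ t)) - real (count_below X m)\<bar>
    \<le> real (card (mismatches X a t))"
proof -
  let ?A = "{s. s < m \<and> X (a * 2 ^ t + s)}" and ?B = "{s. s < m \<and> X s}"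
  have "card ?A \<le> card (?B \<union> mismatches X a t)" "card ?B \<le> card (?A \<union> mismatches X a t)"
    using assms by (auto intro!: card_mono simp: mismatches_def)
  then have "card ?A \<le> card ?B + card (mismatches X a t)" "card ?B \<le> card ?A + card (mismatches X a t)"
    using card_Un_le le_trans by blast+
  then show ?thesis unfolding count_below_add unfolding count_below_def by linarith
qed

text \<open>Counts up to \<open>2 ^ t\<close> double up to an error linear in \<open>t\<close>,
  which makes the normalised counts converge. A general \<open>N\<close> is handled by removing its
  leading binary digit, at linear cost per digit, hence the square.\<close>

lemma linear_mismatch_density:
  assumes "linear_mismatch X"
  obtains \<delta> K :: real where "K \<ge> 0"
    "\<And>t N. N < 2 ^ t \<Longrightarrow> \<bar>real (count_below X N) - \<delta> * real N\<bar> \<le> K * (real t + 1)\<^sup>2"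
proof -
  obtain K0 :: nat where K0: "\<And>a t. card (mismatches X a t) \<le> K0 * (t + 1)"
    using assms unfolding linear_mismatch_def by blast
  define K where "K = real K0"
  have "K \<ge> 0" by (simp add: K_def)
  have K: "real (card (mismatches X a t)) \<le> K * (real t + 1)" for a t
    using of_nat_mono[OF K0[of a t], where ?'a = real] by (simp add: K_def algebra_simps)
  define C where "C N = real (count_below X N)" for N
  have add: "\<bar>C (2 ^ t + m) - C (2 ^ t) - C m\<bar> \<le> K * (real t + 1)" if "m \<le> 2 ^ t" for t m
    using count_below_block[OF that, of X 1] K[of 1 t] unfolding C_def by simp
  have dbl: "\<bar>C (2 ^ Suc t) - 2 * C (2 ^ t)\<bar> \<le> K * (real t + 1)" for t
    using add[of "2 ^ t" t] by (simp add: mult_2[symmetric])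
  \<comment> \<open>The correction obeys \<open>2 * (t + 2) = (t + 3) + (t + 1)\<close>, so it
    absorbs the doubling error exactly: \<open>l\<close> increases, \<open>u\<close> decreases, and
    their separation traps the limit.\<close>
  define l where "l t = (C (2 ^ t) - K * (real t + 2)) / 2 ^ t" for t
  define u where "u t = (C (2 ^ t) + K * (real t + 2)) / 2 ^ t" for t
  have cancel: "2 * x / 2 ^ Suc t = x / 2 ^ t" for x :: real and t by simp
  have "l t \<le> l (Suc t)" for t
  proof -
    have "2 * (C (2 ^ t) - K * (real t + 2)) \<le> C (2 ^ Suc t) - K * (real (Suc t) + 2)"
      using dbl[of t] by (simp add: algebra_simps abs_le_iff)
    then have "2 * (C (2 ^ t) - K * (real t + 2)) / 2 ^ Suc t \<le> (C (2 ^ Suc t) - K * (real (Suc t) + 2)) / 2 ^ Suc t"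
      by (rule divide_right_mono) simp
    then show ?thesis unfolding l_def cancel .
  qed
  then have "incseq l" by (rule incseq_SucI)
  have "u (Suc t) \<le> u t" for t
  proof -
    have "C (2 ^ Suc t) + K * (real (Suc t) + 2) \<le> 2 * (C (2 ^ t) + K * (real t + 2))"
      using dbl[of t] by (simp add: algebra_simps abs_le_iff)
    then have "(C (2 ^ Suc t) + K * (real (Suc t) + 2)) / 2 ^ Suc t \<le> 2 * (C (2 ^ t) + K * (real t + 2)) / 2 ^ Suc t"
      by (rule divide_right_mono) simp
    then show ?thesis unfolding u_def cancel .
  qed
  then have "decseq u" by (rule decseq_SucI)
  have lu: "l s \<le> u t" for s t
  proof -
    have "l s \<le> l (max s t)" using \<open>incseq l\<close> by (simp add: incseq_def)
    also have "\<dots> \<le> u (max s t)" unfolding l_def u_def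
      using \<open>K \<ge> 0\<close> by (intro divide_right_mono) auto
    also have "\<dots> \<le> u t" using \<open>decseq u\<close> by (simp add: decseq_def)
    finally show ?thesis .
  qed
  define \<delta> where "\<delta> = (SUP s. l s)"
  have "l t \<le> \<delta>" for t
    unfolding \<delta>_def using lu by (intro cSUP_upper bdd_aboveI2) auto
  moreover have "\<delta> \<le> u t" for t
    unfolding \<delta>_def using lu by (intro cSUP_least) auto
  ultimately have pow: "\<bar>C (2 ^ t) - \<delta> * 2 ^ t\<bar> \<le> K * (real t + 2)" for t
    unfolding l_def u_def by (simp add: pos_divide_le_eq pos_le_divide_eq abs_le_iff)
      (metis add.commute diff_le_eq)
  have "\<bar>C N - \<delta> * real N\<bar> \<le> K * (real t + 1)\<^sup>2" if "N < 2 ^ t" for t N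
    using that
  proof (induction t arbitrary: N)
    case 0
    then show ?case using \<open>K \<ge> 0\<close> by (simp add: C_def count_below_def)
  next
    case (Suc t)
    have mono: "K * (real t + 1)\<^sup>2 \<le> K * (real (Suc t) + 1)\<^sup>2"
      using \<open>K \<ge> 0\<close> by (intro mult_left_mono power_mono) auto
    show ?case
    proof (cases "N < 2 ^ t")
      case True
      then show ?thesis using Suc.IH mono order_trans by blast
    next
      case False
      then obtain m where m: "N = 2 ^ t + m" by (metis le_iff_add not_less)
      then have "m < 2 ^ t" using Suc.prems by simp
      have "\<bar>C N - \<delta> * real N\<bar> \<le> \<bar>C (2 ^ t + m) - C (2 ^ t) - C m\<bar> + \<bar>C (2 ^ t) - \<delta> * 2 ^ t\<bar> + \<bar>C m - \<delta> * real m\<bar>"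
        unfolding m by (simp add: algebra_simps)
      also have "\<dots> \<le> K * (real t + 1) + K * (real t + 2) + K * (real t + 1)\<^sup>2"
        using \<open>m < 2 ^ t\<close> by (intro add_mono add pow Suc.IH) auto
      \<comment> \<open>The cost \<open>2 * t + 3\<close> of this digit is the difference of the
        squares of \<open>t + 2\<close> and \<open>t + 1\<close>.\<close>
      also have "\<dots> = K * (real (Suc t) + 1)\<^sup>2" by (simp add: power2_eq_square algebra_simps)
      finally show ?thesis .
    qed
  qed
  with that[OF \<open>K \<ge> 0\<close>] show ?thesis unfolding C_def by blast
qed

section \<open>The periodicity function\<close>

lemma suffix_map_upt:
  fixes f g :: "nat \<Rightarrow> 'a"
  shows "suffix (map f [a..<a + m]) (map g [c..<c + l]) \<longleftrightarrow>
    m \<le> l \<and> (\<forall>j<m. f (a + j) = g (c + (l - m) + j))"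
proof -
  have "suffix xs ys \<longleftrightarrow> length xs \<le> length ys \<and> xs = drop (length ys - length xs) ys" for xs ys :: "'a list"
    unfolding suffix_def by (metis append_eq_conv_conj append_take_drop_id diff_add_inverse2 le_add2 length_append)
  then have "suffix (map f [a..<a + m]) (map g [c..<c + l]) \<longleftrightarrow>
      m \<le> l \<and> map f [a..<a + m] = drop (l - m) (map g [c..<c + l])" by simp
  then show ?thesis by (auto simp: list_eq_iff_nth_eq add.assoc)
qed

text \<open>A word fitting into the past is a square at \<open>i\<close>; a longer one gives a
  period on the whole prefix, written as a window starting at 0.\<close>

lemma periodicity_rudin_shapiro:
  "periodicity rudin_shapiro i =
    (LEAST n. n > 0 \<and> (square_at n i \<or> i \<le> n \<and> (\<forall>j. 0 \<le> j \<and> j < i \<longrightarrow> rs (j + n) = rs j)))"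
proof -
  have eq: "rudin_shapiro a = rudin_shapiro b \<longleftrightarrow> rs a = rs b" for a b
    unfolding rudin_shapiro_def by simp
  have 1: "suffix (factor rudin_shapiro i n) (factor rudin_shapiro 0 i) \<longleftrightarrow> square_at n i" for n
  proof -
    have "suffix (factor rudin_shapiro i n) (factor rudin_shapiro 0 i) \<longleftrightarrow>
        n \<le> i \<and> (\<forall>j<n. rudin_shapiro (i + j) = rudin_shapiro (i - n + j))"
      using suffix_map_upt[of rudin_shapiro i n rudin_shapiro 0 i] unfolding factor_def by simp
    then show ?thesis unfolding square_at_def eq by metis
  qed
  have 2: "suffix (factor rudin_shapiro 0 i) (factor rudin_shapiro i n) \<longleftrightarrow>
      i \<le> n \<and> (\<forall>j. 0 \<le> j \<and> j < i \<longrightarrow> rs (j + n) = rs j)" for n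
  proof (cases "i \<le> n")
    case True
    then have "suffix (factor rudin_shapiro 0 i) (factor rudin_shapiro i n) \<longleftrightarrow>
        i \<le> n \<and> (\<forall>j<i. rudin_shapiro j = rudin_shapiro (n + j))"
      using suffix_map_upt[of rudin_shapiro 0 i rudin_shapiro i n] unfolding factor_def by simp
    then show ?thesis unfolding eq by (metis le0 add.commute)
  next
    case False
    then show ?thesis
      using suffix_map_upt[of rudin_shapiro 0 i rudin_shapiro i n]
      unfolding factor_def by auto
  qed
  show ?thesis unfolding periodicity_def 1 2 ..
qed

text \<open>The added digit 1 stands at position \<open>m + 1\<close>, while position
  \<open>m\<close> of \<open>j\<close> holds 0, so no block 11 arises.\<close>

lemma rs_add_power:
  assumes "j < 2 ^ m"
  shows "rs (j + 2 ^ Suc m) = rs j"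
  using assms
proof (induction m arbitrary: j)
  case 0
  have "rs (2 * 1) = rs 1" by (rule rs_double)
  also have "rs 1 = rs 0" using rs_double_Suc[of 0] by simp
  finally have "rs (0 + 2 ^ Suc 0) = rs 0" unfolding power_Suc power_0 add_0 .
  then show ?case using 0 by simp
next
  case (Suc m)
  show ?case
  proof (cases "even j")
    case True
    then obtain i where i: "j = 2 * i" by blast
    have "j + 2 ^ Suc (Suc m) = 2 * (i + 2 ^ Suc m)" using i by simp
    moreover have "rs (i + 2 ^ Suc m) = rs i" using i Suc by simp
    ultimately show ?thesis using i by (metis rs_double)
  next
    case False
    then obtain i where i: "j = Suc (2 * i)" by (metis oddE Suc_eq_plus1)
    have "j + 2 ^ Suc (Suc m) = Suc (2 * (i + 2 ^ Suc m))" using i by simp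
    moreover have "rs (i + 2 ^ Suc m) = rs i" using i Suc by simp
    moreover have "odd (i + 2 ^ Suc m) = odd i" by simp
    ultimately show ?thesis using i by (metis rs_double_Suc)
  qed
qed

text \<open>At a square centre the value is at most 7 or \<open>2 * 2 ^ t\<close>. Elsewhere it is a
  period of the entire prefix, and parity arguments force \<open>4 * 2 ^ k\<close> unless
  \<open>i\<close> is below 9 or a power of two. Errors are charged to a power of two dividing
  \<open>i\<close>, which keeps their sum small.\<close>

lemma periodicity_estimate:
  assumes k: "2 ^ k \<le> i" "i < 2 ^ Suc k"
  obtains t where "2 ^ t dvd i"
    "\<bar>real (periodicity rudin_shapiro i) - 4 * 2 ^ k * of_bool (\<not> square_centre i)\<bar> \<le> 32 + 4 * 2 ^ t"
proof -
  define adm where "adm n \<longleftrightarrow> n > 0 \<and> (square_at n i \<or> i \<le> n \<and> (\<forall>j. 0 \<le> j \<and> j < i \<longrightarrow> rs (j + n) = rs j))" for n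
  define p where "p = periodicity rudin_shapiro i"
  have p: "p = (LEAST n. adm n)" unfolding p_def periodicity_rudin_shapiro adm_def ..
  have "adm (2 ^ Suc (Suc k))"
    unfolding adm_def
  proof (intro conjI disjI2 allI impI)
    show "i \<le> 2 ^ Suc (Suc k)" using k by simp
    show "rs (j + 2 ^ Suc (Suc k)) = rs j" if "0 \<le> j \<and> j < i" for j
      using that k by (intro rs_add_power) linarith
  qed simp
  then have "adm p" and "p \<le> 2 ^ Suc (Suc k)" unfolding p by (rule LeastI, rule Least_le)
  then have p_le: "real p \<le> 4 * 2 ^ k"
    using of_nat_mono[of p "2 ^ Suc (Suc k)", where ?'a = real] by simp
  show ?thesis
  proof (cases "square_centre i")
    case True
    then obtain n where n: "n > 0" "square_at n i" unfolding square_centre_def by blast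
    then have "p \<le> n" unfolding p by (intro Least_le) (simp add: adm_def)
    show ?thesis
    proof (cases "even n")
      case True
      with square_at_even[OF n(2)] n(1) obtain t q where "n = 2 ^ Suc t" "i = 2 ^ t * (2 * q + 1)" by blast
      with \<open>p \<le> n\<close> have "2 ^ t dvd i" "real p \<le> 2 * 2 ^ t"
        using of_nat_mono[of p "2 ^ Suc t", where ?'a = real] by auto
      with that[of t] \<open>square_centre i\<close> show ?thesis unfolding p_def by simp
    next
      case False
      with square_at_odd[OF n(2)] \<open>p \<le> n\<close> have "p \<le> 7" by auto
      with that[of 0] \<open>square_centre i\<close> show ?thesis unfolding p_def by simp
    qed
  next
    case False
    then have "p > 0 \<Longrightarrow> \<not> square_at p i" unfolding square_centre_def by blast
    then have "i \<le> p" "p > 0" and per: "\<forall>j. 0 \<le> j \<and> j < i \<longrightarrow> rs (j + p) = rs j"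
      using \<open>adm p\<close> unfolding adm_def by blast+
    show ?thesis
    proof (cases "odd p")
      case True
      \<comment> \<open>Here \<open>k\<close> is at most 3, so both values lie between 0 and
        \<open>4 * 2 ^ 3 = 32\<close>; this fixes the constant in the estimate.\<close>
      then have "i < 9" using rs_period_odd[OF per] by simp
      then have "(2::nat) ^ k < 2 ^ 4" using k by simp
      then have "k < 4" by (subst (asm) power_strict_increasing_iff) auto
      then have "(2::real) ^ k \<le> 2 ^ 3" by (intro power_increasing) auto
      with p_le that[of 0] False show ?thesis unfolding p_def by (simp add: abs_le_iff)
    next
      case even: False
      obtain s u where su: "p = 2 ^ s * (2 * u + 1)" using odd_part_exists[OF \<open>p > 0\<close>] .
      with even obtain t where t: "s = Suc t" by (cases s) auto
      have pt: "p = 2 ^ Suc t * (2 * u + 1)" using su t by simp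
      \<comment> \<open>The window starts at 0, so the first odd multiple is \<open>2 ^ t\<close>
        itself.\<close>
      have "i \<le> 2 ^ t * (2 * 0 + 1)" by (rule rs_period_even[OF per pt]) simp
      then consider "i = 2 ^ t" | "i < 2 ^ t" by force
      then show ?thesis
      proof cases
        case 1
        then have "2 ^ k \<le> (2::nat) ^ t" using k by simp
        then have "(2::real) ^ k \<le> 2 ^ t" by simp
        then have "\<bar>real p - 4 * 2 ^ k\<bar> \<le> 32 + 4 * 2 ^ t" using p_le of_nat_0_le_iff[of p] by linarith
        then show ?thesis using that[of t] False 1 unfolding p_def by simp
      next
        case 2
        with k have "(2::nat) ^ k < 2 ^ t" by (meson le_less_trans)
        \<comment> \<open>The power of two in \<open>p\<close> is now so large that \<open>p\<close>
          reaches its upper bound \<open>4 * 2 ^ k\<close>.\<close>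
        then have "k < t" by (subst (asm) power_strict_increasing_iff) auto
        then have "(2::nat) ^ Suc (Suc k) \<le> 2 ^ Suc t * 1" unfolding mult_1_right by (intro power_increasing) auto
        also have "\<dots> \<le> p" unfolding pt by (intro mult_left_mono) auto
        finally have "2 ^ Suc (Suc k) \<le> p" .
        then have "real p = 4 * 2 ^ k"
          using p_le of_nat_mono[of "2 ^ Suc (Suc k)" p, where ?'a = real] by simp
        then show ?thesis using that[of 0] False unfolding p_def by simp
      qed
    qed
  qed
qed

section \<open>Summation over dyadic blocks\<close>

lemma card_dyadic_multiples:
  assumes "t \<le> k"
  shows "card {i. 2 ^ k \<le> i \<and> i < 2 ^ Suc k \<and> 2 ^ t dvd (i::nat)} \<le> 2 ^ (k - t)"
proof -
  have pow: "(2::nat) ^ k = 2 ^ t * 2 ^ (k - t)" using assms by (simp flip: power_add)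
  have "{i. 2 ^ k \<le> i \<and> i < 2 ^ Suc k \<and> 2 ^ t dvd (i::nat)} \<subseteq> (\<lambda>u. 2 ^ t * u) ` {2 ^ (k - t)..<2 * 2 ^ (k - t)}"
    by (auto simp: pow)
  then have "card {i. 2 ^ k \<le> i \<and> i < 2 ^ Suc k \<and> 2 ^ t dvd (i::nat)} \<le> card ((\<lambda>u. 2 ^ t * u) ` {2 ^ (k - t)..<2 * 2 ^ (k - t) :: nat})"
    by (rule card_mono[rotated]) simp
  also have "\<dots> \<le> card {2 ^ (k - t)..<2 * 2 ^ (k - t) :: nat}" by (rule card_image_le) simp
  finally show ?thesis by simp
qed

text \<open>After exchanging the sums, each \<open>t\<close> contributes at most
  \<open>2 ^ (k - t)\<close> multiples of weight \<open>2 ^ t\<close>, that is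
  \<open>2 ^ k\<close>.\<close>

lemma sum_dyadic_multiples:
  fixes m :: nat
  assumes "m \<le> 2 ^ k"
  shows "(\<Sum>i = 2 ^ k..<2 ^ k + m. \<Sum>t\<le>k. of_bool (2 ^ t dvd i) * 2 ^ t :: real) \<le> 2 ^ k * real (k + 1)"
proof -
  let ?J = "{2 ^ k..<2 ^ Suc k} :: nat set"
  have "(\<Sum>i = 2 ^ k..<2 ^ k + m. \<Sum>t\<le>k. of_bool (2 ^ t dvd i) * 2 ^ t :: real)
      \<le> (\<Sum>i\<in>?J. \<Sum>t\<le>k. of_bool (2 ^ t dvd i) * 2 ^ t)"
    using assms by (intro sum_mono2 sum_nonneg) auto
  also have "\<dots> = (\<Sum>t\<le>k. \<Sum>i\<in>?J. of_bool (2 ^ t dvd i) * 2 ^ t)"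
    by (rule sum.swap)
  also have "\<dots> \<le> (\<Sum>t\<le>k. 2 ^ k)"
  proof (rule sum_mono)
    fix t assume "t \<in> {..k}"
    then have "t \<le> k" by simp
    have "(\<Sum>i\<in>?J. of_bool (2 ^ t dvd i) * 2 ^ t :: real)
        = real (card (?J \<inter> {i. 2 ^ t dvd i})) * 2 ^ t"
      unfolding sum_distrib_right[symmetric] by (subst sum_of_bool_eq) auto
    also have "?J \<inter> {i. 2 ^ t dvd i} = {i. 2 ^ k \<le> i \<and> i < 2 ^ Suc k \<and> 2 ^ t dvd (i::nat)}"
      by auto
    also have "real (card \<dots>) * 2 ^ t \<le> real (2 ^ (k - t)) * 2 ^ t"
      using card_dyadic_multiples[OF \<open>t \<le> k\<close>] by (intro mult_right_mono of_nat_mono) auto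
    also have "\<dots> = 2 ^ k" using \<open>t \<le> k\<close> by (simp flip: power_add)
    finally show "(\<Sum>i\<in>?J. of_bool (2 ^ t dvd i) * 2 ^ t :: real) \<le> 2 ^ k" .
  qed
  also have "\<dots> = 2 ^ k * real (k + 1)" by simp
  finally show ?thesis .
qed

lemma sum_periodicity_block:
  assumes "m \<le> 2 ^ k"
  defines "X \<equiv> \<lambda>i. \<not> square_centre i"
  shows "\<bar>real (sum_periodicity rudin_shapiro (2 ^ k + m)) - real (sum_periodicity rudin_shapiro (2 ^ k))
    - 4 * 2 ^ k * (real (count_below X (2 ^ k + m)) - real (count_below X (2 ^ k)))\<bar> \<le> 2 ^ k * (4 * real k + 36)"
proof -
  let ?I = "{2 ^ k..<2 ^ k + m}"
  have split: "(\<Sum>i<2 ^ k + m. f i) = (\<Sum>i<2 ^ k. f i) + (\<Sum>i\<in>?I. f i)" for f :: "nat \<Rightarrow> real"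
    unfolding lessThan_atLeast0 by (rule sum.atLeastLessThan_concat[symmetric]) auto
  have count: "real (count_below X N) = (\<Sum>i<N. of_bool (X i))" for N
  proof -
    have "{i. i < N \<and> X i} = {..<N} \<inter> {i. X i}" by auto
    then show ?thesis unfolding count_below_def by (subst sum_of_bool_eq) auto
  qed
  have "real (sum_periodicity rudin_shapiro (2 ^ k + m)) - real (sum_periodicity rudin_shapiro (2 ^ k))
      - 4 * 2 ^ k * (real (count_below X (2 ^ k + m)) - real (count_below X (2 ^ k)))
    = (\<Sum>i\<in>?I. real (periodicity rudin_shapiro i)) - 4 * 2 ^ k * (\<Sum>i\<in>?I. of_bool (X i))"
    unfolding sum_periodicity_def of_nat_sum count split by simp
  also have "\<dots> = (\<Sum>i\<in>?I. real (periodicity rudin_shapiro i) - 4 * 2 ^ k * of_bool (X i))"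
    unfolding sum_subtractf sum_distrib_left ..
  \<comment> \<open>The exponent \<open>t\<close> charged at \<open>i\<close> is not known, so it is
    replaced by all exponents up to \<open>k\<close> with \<open>2 ^ t dvd i\<close>.\<close>
  also have "\<bar>\<dots>\<bar> \<le> (\<Sum>i\<in>?I. 32 + 4 * (\<Sum>t\<le>k. of_bool (2 ^ t dvd i) * 2 ^ t))"
  proof (rule order_trans[OF sum_abs], rule sum_mono)
    fix i assume "i \<in> ?I"
    then have i: "2 ^ k \<le> i" "i < 2 ^ Suc k" using assms(1) by auto
    obtain t where t: "2 ^ t dvd i"
      "\<bar>real (periodicity rudin_shapiro i) - 4 * 2 ^ k * of_bool (X i)\<bar> \<le> 32 + 4 * 2 ^ t"
      using periodicity_estimate[OF i] unfolding X_def by blast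
    have "0 < i" using i(1) by (metis gr0I not_le zero_less_numeral zero_less_power)
    with t(1) i(2) have "(2::nat) ^ t < 2 ^ Suc k" by (meson dvd_imp_le le_less_trans)
    then have "t < Suc k" by (subst (asm) power_strict_increasing_iff) auto
    then have "of_bool (2 ^ t dvd i) * 2 ^ t \<le> (\<Sum>t\<le>k. of_bool (2 ^ t dvd i) * 2 ^ t :: real)"
      by (intro member_le_sum) auto
    with t show "\<bar>real (periodicity rudin_shapiro i) - 4 * 2 ^ k * of_bool (X i)\<bar>
        \<le> 32 + 4 * (\<Sum>t\<le>k. of_bool (2 ^ t dvd i) * 2 ^ t)" by simp
  qed
  also have "\<dots> = 32 * real m + 4 * (\<Sum>i\<in>?I. \<Sum>t\<le>k. of_bool (2 ^ t dvd i) * 2 ^ t)"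
    unfolding sum.distrib sum_distrib_left[symmetric] by simp
  also have "\<dots> \<le> 32 * 2 ^ k + 4 * (2 ^ k * real (k + 1))"
    using of_nat_mono[OF assms(1), where ?'a = real]
    by (intro add_mono mult_left_mono sum_dyadic_multiples assms(1)) auto
  also have "\<dots> = 2 ^ k * (4 * real k + 36)" by (simp add: algebra_simps)
  finally show ?thesis .
qed

text \<open>A full block contributes \<open>c * 4 ^ k\<close>, and these sum geometrically to
  \<open>c * 4 ^ k / 3\<close>. The error doubles from one power of two to the next, as does
  \<open>2 ^ k\<close>, so the quadratic factor is preserved.\<close>

lemma dyadic_block_summation:
  fixes P :: "nat \<Rightarrow> real"
  assumes "M \<ge> 0"
    and block: "\<And>k m. m \<le> 2 ^ k \<Longrightarrow> \<bar>P (2 ^ k + m) - P (2 ^ k) - c * 2 ^ k * real m\<bar> \<le> M * (2 ^ k * (real k + 3)\<^sup>2)"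
  obtains M' where "M' \<ge> 0"
    "\<And>k m. m \<le> 2 ^ k \<Longrightarrow> \<bar>P (2 ^ k + m) - c * (4 ^ k / 3 + 2 ^ k * real m)\<bar> \<le> M' * (2 ^ k * (real k + 3)\<^sup>2)"
proof -
  \<comment> \<open>The second summand pays for the start of the induction at
    \<open>k = 0\<close>.\<close>
  define L where "L = M + \<bar>P 1 - c / 3\<bar>"
  have "L \<ge> M" "L \<ge> 0" using assms(1) unfolding L_def by auto
  have blockL: "\<bar>P (2 ^ k + m) - P (2 ^ k) - c * 2 ^ k * real m\<bar> \<le> L * (2 ^ k * (real k + 3)\<^sup>2)" if "m \<le> 2 ^ k" for k m
    by (rule order_trans[OF block[OF that] mult_right_mono[OF \<open>L \<ge> M\<close>]]) simp
  have pow: "\<bar>P (2 ^ k) - c * (4 ^ k / 3)\<bar> \<le> L * (2 ^ k * (real k + 3)\<^sup>2)" for k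
  proof (induction k)
    case 0
    have "\<bar>P 1 - c / 3\<bar> \<le> L" using assms(1) unfolding L_def by simp
    with \<open>L \<ge> 0\<close> show ?case by (simp add: power2_eq_square)
  next
    case (Suc k)
    have four: "(4::real) ^ k = 2 ^ k * 2 ^ k" by (simp flip: power_mult_distrib)
    have "P (2 ^ Suc k) - c * (4 ^ Suc k / 3)
        = (P (2 ^ k + 2 ^ k) - P (2 ^ k) - c * 2 ^ k * real (2 ^ k)) + (P (2 ^ k) - c * (4 ^ k / 3))"
      by (simp add: four mult_2[symmetric] algebra_simps)
    then have "\<bar>P (2 ^ Suc k) - c * (4 ^ Suc k / 3)\<bar> \<le> L * (2 ^ k * (real k + 3)\<^sup>2) + L * (2 ^ k * (real k + 3)\<^sup>2)"
      using Suc blockL[of "2 ^ k" k] by linarith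
    also have "\<dots> = L * (2 ^ Suc k * (real k + 3)\<^sup>2)" by simp
    also have "\<dots> \<le> L * (2 ^ Suc k * (real (Suc k) + 3)\<^sup>2)"
      using \<open>L \<ge> 0\<close> by (intro mult_left_mono power_mono) auto
    finally show ?case .
  qed
  show ?thesis
  proof (rule that[of "2 * L"])
    fix k m :: nat assume m: "m \<le> 2 ^ k"
    have "P (2 ^ k + m) - c * (4 ^ k / 3 + 2 ^ k * real m)
        = (P (2 ^ k + m) - P (2 ^ k) - c * 2 ^ k * real m) + (P (2 ^ k) - c * (4 ^ k / 3))"
      by (simp add: algebra_simps)
    then show "\<bar>P (2 ^ k + m) - c * (4 ^ k / 3 + 2 ^ k * real m)\<bar> \<le> 2 * L * (2 ^ k * (real k + 3)\<^sup>2)"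
      using pow[of k] blockL[OF m] by linarith
  qed (use \<open>L \<ge> 0\<close> in simp)
qed

lemma sum_periodicity_estimate:
  "\<exists>c M :: real. M \<ge> 0 \<and> (\<forall>k m. m \<le> 2 ^ k \<longrightarrow>
    \<bar>real (sum_periodicity rudin_shapiro (2 ^ k + m)) - c * (4 ^ k / 3 + 2 ^ k * real m)\<bar>
      \<le> M * (2 ^ k * (real k + 3)\<^sup>2))"
proof -
  define C where "C N = real (count_below (\<lambda>i. \<not> square_centre i) N)" for N
  define P where "P N = real (sum_periodicity rudin_shapiro N)" for N
  obtain \<delta> K :: real where K: "K \<ge> 0"
    "\<And>t N. N < 2 ^ t \<Longrightarrow> \<bar>C N - \<delta> * real N\<bar> \<le> K * (real t + 1)\<^sup>2"
    unfolding C_def by (rule linear_mismatch_density[OF linear_mismatch_no_square]) blast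
  have "\<bar>P (2 ^ k + m) - P (2 ^ k) - 4 * \<delta> * 2 ^ k * real m\<bar> \<le> (12 + 8 * K) * (2 ^ k * (real k + 3)\<^sup>2)"
    if m: "m \<le> 2 ^ k" for k m
  proof -
    \<comment> \<open>The density bound is used with exponent \<open>k + 2\<close>, since
      \<open>N = 2 ^ Suc k\<close> is allowed; this is the origin of \<open>k + 3\<close>.\<close>
    have dens: "\<bar>C N - \<delta> * real N\<bar> \<le> K * (real k + 3)\<^sup>2" if "N \<le> 2 ^ Suc k" for N
    proof -
      have "(2::nat) ^ Suc k < 2 ^ (k + 2)" by simp
      with that have "N < 2 ^ (k + 2)" by linarith
      from K(2)[OF this] show ?thesis by (simp add: add.commute)
    qed
    have "\<bar>C (2 ^ k + m) - C (2 ^ k) - \<delta> * real m\<bar> \<le> 2 * (K * (real k + 3)\<^sup>2)"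
      using dens[of "2 ^ k + m"] dens[of "2 ^ k"] m by (simp add: algebra_simps)
    then have "4 * 2 ^ k * \<bar>C (2 ^ k + m) - C (2 ^ k) - \<delta> * real m\<bar> \<le> 4 * 2 ^ k * (2 * (K * (real k + 3)\<^sup>2))"
      by (intro mult_left_mono) auto
    then have 1: "\<bar>4 * 2 ^ k * (C (2 ^ k + m) - C (2 ^ k)) - 4 * \<delta> * 2 ^ k * real m\<bar>
        \<le> 8 * K * (2 ^ k * (real k + 3)\<^sup>2)"
    proof -
      have "4 * 2 ^ k * (C (2 ^ k + m) - C (2 ^ k)) - 4 * \<delta> * 2 ^ k * real m
          = 4 * 2 ^ k * (C (2 ^ k + m) - C (2 ^ k) - \<delta> * real m)" by (simp add: algebra_simps)
      then have "\<bar>4 * 2 ^ k * (C (2 ^ k + m) - C (2 ^ k)) - 4 * \<delta> * 2 ^ k * real m\<bar>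
          = 4 * 2 ^ k * \<bar>C (2 ^ k + m) - C (2 ^ k) - \<delta> * real m\<bar>" by (simp add: abs_mult)
      also have "\<dots> \<le> 4 * 2 ^ k * (2 * (K * (real k + 3)\<^sup>2))" by fact
      finally show ?thesis by (simp add: mult_ac)
    qed
    have "\<bar>P (2 ^ k + m) - P (2 ^ k) - 4 * 2 ^ k * (C (2 ^ k + m) - C (2 ^ k))\<bar> \<le> 2 ^ k * (4 * real k + 36)"
      using sum_periodicity_block[OF m] unfolding P_def C_def .
    also have "\<dots> \<le> 2 ^ k * (12 * (real k + 3)\<^sup>2)"
      by (intro mult_left_mono) (auto simp: power2_eq_square algebra_simps)
    finally have 2: "\<bar>P (2 ^ k + m) - P (2 ^ k) - 4 * 2 ^ k * (C (2 ^ k + m) - C (2 ^ k))\<bar>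
        \<le> 12 * (2 ^ k * (real k + 3)\<^sup>2)" by simp
    from 1 2 show ?thesis unfolding distrib_right by linarith
  qed
  then obtain M where "M \<ge> 0" "\<And>k m. m \<le> 2 ^ k \<Longrightarrow>
      \<bar>P (2 ^ k + m) - 4 * \<delta> * (4 ^ k / 3 + 2 ^ k * real m)\<bar> \<le> M * (2 ^ k * (real k + 3)\<^sup>2)"
    using K(1) by (rule_tac dyadic_block_summation[of "12 + 8 * K" P "4 * \<delta>"]) auto
  then show ?thesis unfolding P_def by blast
qed

section \<open>The periodic function and the asymptotics\<close>

text \<open>On each closed interval between consecutive integers the function is a translate of
  \<open>h\<close>, the right endpoint being correct by \<open>h 0 = h 1\<close>. Two adjacent
  intervals cover a neighbourhood of any point, integers included.\<close>

lemma continuous_on_frac: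
  fixes h :: "real \<Rightarrow> 'a::topological_space"
  assumes cont: "continuous_on {0..1} h" and "h 0 = h 1"
  shows "continuous_on UNIV (\<lambda>y. h (frac y))"
proof -
  have unit: "continuous_on {of_int k..of_int k + 1} (\<lambda>y. h (frac y))" for k :: int
  proof -
    have "continuous_on {of_int k..of_int k + 1} (\<lambda>y. h (y - of_int k))"
      by (rule continuous_on_compose2[OF cont]) (auto intro!: continuous_intros)
    moreover have "h (frac y) = h (y - of_int k)" if "y \<in> {of_int k..of_int k + 1}" for y
    proof (cases "y = of_int k + 1")
      case True
      then have "frac y = 0" by (simp add: frac_def)
      with True assms(2) show ?thesis by simp
    next
      case False
      with that have "\<lfloor>y\<rfloor> = k" by (intro floor_unique) auto
      then show ?thesis by (simp add: frac_def)
    qed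
    ultimately show ?thesis by (subst continuous_on_cong[OF refl]) auto
  qed
  have "isCont (\<lambda>y. h (frac y)) x" for x
  proof -
    define k where "k = \<lfloor>x\<rfloor>"
    have "continuous_on ({of_int (k - 1)..of_int (k - 1) + 1} \<union> {of_int k..of_int k + 1}) (\<lambda>y. h (frac y))"
      by (intro continuous_on_closed_Un unit) auto
    then have "continuous_on {of_int k - 1<..<of_int k + 1} (\<lambda>y. h (frac y))"
      by (rule continuous_on_subset) auto
    moreover have "x \<in> {of_int k - 1<..<of_int k + 1}"
      unfolding k_def by simp linarith
    ultimately show ?thesis by (simp add: continuous_on_eq_continuous_at)
  qed
  then show ?thesis by (simp add: continuous_on_eq_continuous_at)
qed

theorem theorem6:
  "\<exists>\<Phi> :: real \<Rightarrow> complex.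
     (\<forall>x. \<Phi> (x + 1) = \<Phi> x) \<and> continuous_on UNIV \<Phi> \<and>
     (\<lambda>n::nat. of_nat (sum_periodicity rudin_shapiro n)
          - of_nat n ^ 2 * \<Phi> (frac (log 2 (real n))))
       \<in> O(\<lambda>n. complex_of_real (real n * ln (real n) ^ 2)) \<and>
     (\<lambda>n::nat. complex_of_real (mean_periodicity rudin_shapiro n)
          - of_nat n * \<Phi> (frac (log 2 (real n))))
       \<in> O(\<lambda>n. complex_of_real (ln (real n) ^ 2))"
proof -
  obtain c M :: real where "M \<ge> 0" and est:
    "\<And>k m. m \<le> 2 ^ k \<Longrightarrow> \<bar>real (sum_periodicity rudin_shapiro (2 ^ k + m)) - c * (4 ^ k / 3 + 2 ^ k * real m)\<bar>
      \<le> M * (2 ^ k * (real k + 3)\<^sup>2)"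
    using sum_periodicity_estimate by blast
  \<comment> \<open>With \<open>n = 2 ^ k * x\<close> and \<open>m = 2 ^ k * (x - 1)\<close> the
    main term is \<open>c * 4 ^ k * (x - 2 / 3)\<close>; division by \<open>n\<^sup>2\<close> gives
    \<open>g x\<close>.\<close>
  define g where "g x = c * (x - 2 / 3) / x\<^sup>2" for x :: real
  define \<Phi> where "\<Phi> y = complex_of_real (g (2 powr frac y))" for y
  \<comment> \<open>The factor 16 comes from \<open>k + 3 \<le> 4 * log 2 n\<close> for
    \<open>n \<ge> 2\<close>, and the denominator from passing to \<open>ln\<close>.\<close>
  define D where "D = 16 * M / (ln 2)\<^sup>2"
  have bound: "\<bar>real (sum_periodicity rudin_shapiro n) - (real n)\<^sup>2 * g (2 powr frac (log 2 (real n)))\<bar>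
      \<le> D * (real n * (ln (real n))\<^sup>2)" if "n \<ge> 2" for n :: nat
  proof -
    obtain k where k: "2 ^ k \<le> n" "n < 2 ^ Suc k"
      using ex_power_ivl1[of 2 n] \<open>n \<ge> 2\<close> by auto
    then obtain m where m: "n = 2 ^ k + m" by (metis le_iff_add)
    have "m \<le> 2 ^ k" using k m by simp
    have n: "real n > 0" using that by simp
    have kn: "2 ^ k \<le> real n" "real n < 2 ^ Suc k"
      using of_nat_mono[OF k(1), where ?'a = real] k(2) by (simp, metis of_nat_less_iff of_nat_numeral of_nat_power)
    have "real k \<le> log 2 (real n)" "log 2 (real n) < real k + 1"
    proof -
      have "log 2 (2 ^ k) \<le> log 2 (real n)" using kn n by (subst log_le_cancel_iff) auto
      then show "real k \<le> log 2 (real n)" by (simp add: log_nat_power)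
      have "log 2 (real n) < log 2 (2 ^ Suc k)" using kn n by (subst log_less_cancel_iff) auto
      then show "log 2 (real n) < real k + 1" by (simp add: log_nat_power del: power_Suc)
    qed
    then have "\<lfloor>log 2 (real n)\<rfloor> = int k" by (intro floor_unique) auto
    then have "2 powr frac (log 2 (real n)) = real n / 2 ^ k"
      using n by (simp add: frac_def powr_diff powr_realpow)
    moreover have "(real n)\<^sup>2 * g (real n / 2 ^ k) = c * (4 ^ k / 3 + 2 ^ k * real m)"
    proof -
      have four: "(4::real) ^ k = 2 ^ k * 2 ^ k" by (simp flip: power_mult_distrib)
      have rm: "real m = real n - 2 ^ k" using m by simp
      have "(real n)\<^sup>2 * g (real n / 2 ^ k) = c * ((real n / 2 ^ k - 2 / 3) * (2 ^ k * 2 ^ k))"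
        using n unfolding g_def by (simp add: power2_eq_square)
      also have "(real n / 2 ^ k - 2 / 3) * (2 ^ k * 2 ^ k) = 4 ^ k / 3 + 2 ^ k * real m"
        unfolding four rm by (simp add: field_simps)
      finally show ?thesis .
    qed
    ultimately have "\<bar>real (sum_periodicity rudin_shapiro n) - (real n)\<^sup>2 * g (2 powr frac (log 2 (real n)))\<bar>
        \<le> M * (2 ^ k * (real k + 3)\<^sup>2)"
      using est[OF \<open>m \<le> 2 ^ k\<close>] m by simp
    also have "\<dots> \<le> M * (real n * (4 * log 2 (real n))\<^sup>2)"
    proof -
      have "log 2 2 \<le> log 2 (real n)" using that by (subst log_le_cancel_iff) auto
      then have "real k + 3 \<le> 4 * log 2 (real n)" using \<open>real k \<le> log 2 (real n)\<close> by simp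
      then show ?thesis using \<open>M \<ge> 0\<close> kn by (intro mult_left_mono mult_mono power_mono) auto
    qed
    also have "\<dots> = D * (real n * (ln (real n))\<^sup>2)"
      unfolding D_def log_def by (simp add: power_divide power_mult_distrib)
    finally show ?thesis .
  qed
  \<comment> \<open>The endpoint values match: \<open>g 1\<close> and \<open>g 2\<close> both equal
    \<open>c / 3\<close>.\<close>
  have "continuous_on UNIV \<Phi>"
    unfolding \<Phi>_def by (rule continuous_on_frac) (auto simp: g_def intro!: continuous_intros)
  moreover have "\<forall>x. \<Phi> (x + 1) = \<Phi> x" by (simp add: \<Phi>_def frac_1_eq)
  moreover have "(\<lambda>n::nat. of_nat (sum_periodicity rudin_shapiro n)
        - of_nat n ^ 2 * \<Phi> (frac (log 2 (real n))))
      \<in> O(\<lambda>n. complex_of_real (real n * ln (real n) ^ 2))"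
  proof (rule bigoI[of _ D], rule eventually_mono[OF eventually_ge_at_top[of 2]])
    fix n :: nat assume "2 \<le> n"
    have "of_nat (sum_periodicity rudin_shapiro n) - of_nat n ^ 2 * \<Phi> (frac (log 2 (real n)))
        = complex_of_real (real (sum_periodicity rudin_shapiro n) - (real n)\<^sup>2 * g (2 powr frac (log 2 (real n))))"
      unfolding \<Phi>_def by simp
    with bound[OF \<open>2 \<le> n\<close>] show "cmod (of_nat (sum_periodicity rudin_shapiro n) - of_nat n ^ 2 * \<Phi> (frac (log 2 (real n))))
        \<le> D * cmod (complex_of_real (real n * ln (real n) ^ 2))"
      by (simp only: norm_of_real) simp
  qed
  moreover have "(\<lambda>n::nat. complex_of_real (mean_periodicity rudin_shapiro n)
        - of_nat n * \<Phi> (frac (log 2 (real n))))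
      \<in> O(\<lambda>n. complex_of_real (ln (real n) ^ 2))"
  proof (rule bigoI[of _ D], rule eventually_mono[OF eventually_ge_at_top[of 2]])
    fix n :: nat assume "2 \<le> n"
    let ?x = "real (sum_periodicity rudin_shapiro n) - (real n)\<^sup>2 * g (2 powr frac (log 2 (real n)))"
    have "complex_of_real (mean_periodicity rudin_shapiro n) - of_nat n * \<Phi> (frac (log 2 (real n)))
        = complex_of_real (mean_periodicity rudin_shapiro n - real n * g (2 powr frac (log 2 (real n))))"
      unfolding \<Phi>_def by simp
    also have "mean_periodicity rudin_shapiro n - real n * g (2 powr frac (log 2 (real n))) = ?x / real n"
      using \<open>2 \<le> n\<close> unfolding mean_periodicity_def by (simp add: field_simps power2_eq_square)
    finally have "cmod (complex_of_real (mean_periodicity rudin_shapiro n) - of_nat n * \<Phi> (frac (log 2 (real n))))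
        = \<bar>?x\<bar> / real n" by (simp only: norm_of_real) simp
    also have "\<dots> \<le> D * (real n * (ln (real n))\<^sup>2) / real n"
      using bound[OF \<open>2 \<le> n\<close>] by (intro divide_right_mono) auto
    finally show "cmod (complex_of_real (mean_periodicity rudin_shapiro n) - of_nat n * \<Phi> (frac (log 2 (real n))))
        \<le> D * cmod (complex_of_real (ln (real n) ^ 2))"
      using \<open>2 \<le> n\<close> by (simp add: norm_power)
  qed
  ultimately show ?thesis by blast
qed

end
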